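(* Let $N \geqslant 2$, and let $\{ n_i : i \geqslant 0 \} \subset \mathbb{Z}^{\geqslant 0} \cup [N-2,\infty)$ be a set of pairwise distinct real numbers (indexed by the integers $i \geqslant 0$). For each $i$, let $\epsilon_i \in \{-1,0,+1\}$ be a sign such that whenever $\epsilon_{i_0} = -1$, one has $\epsilon_i = +1$ for at least $N$ choices of $i$ satisfying $n_i < n_{i_0}$. Let $0 < \rho < +\infty$. Then there exists a convergent series with real coefficients $$f(x) = \sum_{i=0}^\infty c_{n_i} x^{n_i}$$ on $(0,\rho)$ that is an entrywise positivity preserver on $\mathbb{P}_N((0,\rho))$, such that $c_{n_i}$ has the sign of $\epsilon_i$ for all $i \geqslant 0$ (negative, zero, or positive according as $\epsilon_i=-1,0,+1$).
   Context: For $I \subset \mathbb{C}$, $\mathbb{P}_N(I)$ denotes the set of positive semidefinite Hermitian $N\times N$ matrices all of whose entries lie in $I$. For a function $f$ on $I$ and $A=(a_{jk})$ with entries in $I$, $f[A] := (f(a_{jk}))$ is the entrywise application. The function $f$ is an entrywise positivity preserver on $\mathbb{P}_N(I)$ if $f[A]$ is positive semidefinite for every $A \in \mathbb{P}_N(I)$. *)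

theory Defs
  imports Complex_Main "Jordan_Normal_Form.Schur_Decomposition"
begin

text \<open>The quadratic form \<open>v\<^sup>* A v\<close> is \<open>(A *\<^sub>v v) \<bullet>c v\<close>, as \<open>\<bullet>c\<close> conjugates its second argument.
  It is real because \<open>A\<close> is Hermitian, so taking its real part loses nothing.\<close>

definition hermitian_psd :: "nat \<Rightarrow> complex mat \<Rightarrow> bool" where
  "hermitian_psd N A \<longleftrightarrow>
     A \<in> carrier_mat N N \<and> mat_adjoint A = A \<and>
     (\<forall>v \<in> carrier_vec N. Re ((A *\<^sub>v v) \<bullet>c v) \<ge> 0)"

definition psd_matrices :: "nat \<Rightarrow> complex set \<Rightarrow> complex mat set" where
  "psd_matrices N I = {A. hermitian_psd N A \<and> elements_mat A \<subseteq> I}"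

text \<open>A function on \<open>I\<close> is a total function whose values off \<open>I\<close> are irrelevant: \<open>map_mat f A\<close>
  only evaluates \<open>f\<close> at the entries of \<open>A\<close>.\<close>

definition entrywise_positivity_preserver ::
    "(complex \<Rightarrow> complex) \<Rightarrow> nat \<Rightarrow> complex set \<Rightarrow> bool" where
  "entrywise_positivity_preserver f N I \<longleftrightarrow>
     (\<forall>A \<in> psd_matrices N I. hermitian_psd N (map_mat f A))"

end

theory Submission
  imports Defs "HOL-Analysis.Convex"
begin

text \<open>The heart of the matter is a domination statement: if \<open>M\<close> exceeds \<open>N\<close> distinct exponents
  \<open>e 1, \<dots>, e N\<close>, and each of these \<open>N + 1\<close> numbers is a nonnegative integer or at least \<open>N - 2\<close>,
  then for some constant \<open>C\<close> the function
  \<open>C (x\<^bsup>e 1\<^esup> + \<dots> + x\<^bsup>e N\<^esup>) - x\<^sup>M\<close> preserves positivity on \<open>N\<close> by \<open>N\<close> matrices with entries in \<open>(0, \<rho>)\<close>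
  (lemma \<open>power_domination\<close>). Any negative term preceded by \<open>N\<close> positive ones can
  therefore be absorbed by a small share of them, provided its coefficient is small enough. Giving the
  \<open>i\<close>-th negative term the share \<open>2\<^bsup>-(i+2)\<^esup>\<close> of the positive part, the negative terms together use up at
  most half of it (lemma \<open>series_preserves_psd\<close>).

  For a rank-one matrix \<open>z z\<^sup>T\<close> domination follows once the vector \<open>z\<^sup>M\<close> is a
  combination of the vectors \<open>z\<^bsup>e i\<^esup>\<close> with coefficients bounded independently of \<open>z\<close>. This is interpolation of
  \<open>x\<^sup>M\<close> at \<open>N\<close> points of a bounded interval by generalised polynomials, and the bound on
  the coefficients (lemma \<open>interpolation_coefficients_bounded\<close>) comes from Rolle's theorem by induction
  on \<open>N\<close>; this takes the place of the usual estimates of generalised Vandermonde determinants. Passing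
  from rank one to all ranks is the extension principle of FitzGerald and Horn (lemma
  \<open>preserves_psd_from_derivative\<close>): a function preserves positivity in size \<open>N\<close> if it does so on rank-one
  matrices and its derivative does so in size \<open>N - 1\<close>. The derivative of the function above has the same
  shape with all exponents lowered by one, which is where the condition on the exponents enters.\<close>

section \<open>Quadratic forms and the Schur product\<close>

text \<open>Matrices are functions on an arbitrary finite index set rather than on \<open>{..<N}\<close>, because the inductions
  below delete one index and should not have to renumber the others.\<close>

definition quad_form :: "'i set \<Rightarrow> ('i \<Rightarrow> 'i \<Rightarrow> real) \<Rightarrow> ('i \<Rightarrow> real) \<Rightarrow> real" where
  "quad_form I a x = (\<Sum>i\<in>I. \<Sum>j\<in>I. x i * x j * a i j)"

definition psd_on :: "'i set \<Rightarrow> ('i \<Rightarrow> 'i \<Rightarrow> real) \<Rightarrow> bool" where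
  "psd_on I a \<longleftrightarrow> (\<forall>i\<in>I. \<forall>j\<in>I. a i j = a j i) \<and> (\<forall>x. 0 \<le> quad_form I a x)"

lemma psd_onI:
  assumes "\<And>i j. i \<in> I \<Longrightarrow> j \<in> I \<Longrightarrow> a i j = a j i" and "\<And>x. 0 \<le> quad_form I a x"
  shows "psd_on I a"
  using assms by (simp add: psd_on_def)

lemma psd_on_sym: "psd_on I a \<Longrightarrow> i \<in> I \<Longrightarrow> j \<in> I \<Longrightarrow> a i j = a j i"
  by (simp add: psd_on_def)

lemma psd_on_quad_form: "psd_on I a \<Longrightarrow> 0 \<le> quad_form I a x"
  by (simp add: psd_on_def)

lemma quad_form_add: "quad_form I (\<lambda>i j. a i j + b i j) x = quad_form I a x + quad_form I b x"
  by (simp add: quad_form_def algebra_simps sum.distrib)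

lemma quad_form_diff: "quad_form I (\<lambda>i j. a i j - b i j) x = quad_form I a x - quad_form I b x"
  by (simp add: quad_form_def algebra_simps sum_subtractf)

lemma quad_form_scale: "quad_form I (\<lambda>i j. c * a i j) x = c * quad_form I a x"
  by (simp add: quad_form_def algebra_simps sum_distrib_left)

lemma quad_form_sum:
  "quad_form I (\<lambda>i j. \<Sum>k\<in>K. a k i j) x = (\<Sum>k\<in>K. quad_form I (a k) x)"
proof -
  have "quad_form I (\<lambda>i j. \<Sum>k\<in>K. a k i j) x = (\<Sum>i\<in>I. \<Sum>j\<in>I. \<Sum>k\<in>K. x i * x j * a k i j)"
    by (simp add: quad_form_def sum_distrib_left)
  also have "\<dots> = (\<Sum>i\<in>I. \<Sum>k\<in>K. \<Sum>j\<in>I. x i * x j * a k i j)"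
    by (intro sum.cong refl sum.swap)
  also have "\<dots> = (\<Sum>k\<in>K. quad_form I (a k) x)"
    unfolding quad_form_def by (rule sum.swap)
  finally show ?thesis .
qed

lemma quad_form_rank_one: "quad_form I (\<lambda>i j. z i * z j) x = (\<Sum>i\<in>I. z i * x i)\<^sup>2"
  by (simp add: quad_form_def power2_eq_square sum_product algebra_simps)

lemma quad_form_zero_row:
  assumes "finite I" "l \<in> I" "\<And>i. i \<in> I \<Longrightarrow> a i l = 0" "\<And>i. i \<in> I \<Longrightarrow> a l i = 0"
  shows "quad_form I a x = quad_form (I - {l}) a x"
proof -
  have "(\<Sum>j\<in>I. x i * x j * a i j) = (\<Sum>j\<in>I - {l}. x i * x j * a i j)" if "i \<in> I" for i
    using that assms by (subst sum.remove[of I l]) auto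
  then show ?thesis
    unfolding quad_form_def using assms by (subst sum.remove[of I l]) auto
qed

lemma psd_on_subset:
  assumes "psd_on I a" "J \<subseteq> I" "finite I"
  shows "psd_on J a"
proof (rule psd_onI)
  show "a i j = a j i" if "i \<in> J" "j \<in> J" for i j
    using assms that psd_on_sym by (metis subsetD)
  fix x :: "'a \<Rightarrow> real"
  define y where "y i = (if i \<in> J then x i else 0)" for i
  have "quad_form I a y = (\<Sum>i\<in>I. \<Sum>j\<in>J. y i * y j * a i j)"
    unfolding quad_form_def using assms
    by (intro sum.cong refl sum.mono_neutral_right) (auto simp: y_def)
  also have "\<dots> = (\<Sum>i\<in>J. \<Sum>j\<in>J. y i * y j * a i j)"
    using assms by (intro sum.mono_neutral_right) (auto simp: y_def)
  also have "\<dots> = quad_form J a x"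
    unfolding quad_form_def by (intro sum.cong refl) (auto simp: y_def)
  finally show "0 \<le> quad_form J a x"
    using psd_on_quad_form[OF assms(1), of y] by simp
qed

lemma quad_form_shift:
  assumes "finite I" "l \<in> I" and sym: "\<And>i j. i \<in> I \<Longrightarrow> j \<in> I \<Longrightarrow> a i j = a j i"
  shows "quad_form I a (\<lambda>i. x i + (if i = l then t else 0)) =
         quad_form I a x + 2 * t * (\<Sum>i\<in>I. a i l * x i) + t\<^sup>2 * a l l"
proof -
  define d where "d i = (if i = l then t else 0)" for i
  have 1: "(\<Sum>i\<in>I. \<Sum>j\<in>I. x i * d j * a i j) = t * (\<Sum>i\<in>I. a i l * x i)"
  proof -
    have "(\<Sum>j\<in>I. x i * d j * a i j) = t * (a i l * x i)" for i
      using assms(1,2) by (subst sum.remove[of I l]) (auto simp: d_def)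
    then show ?thesis by (simp add: sum_distrib_left)
  qed
  have 2: "(\<Sum>i\<in>I. \<Sum>j\<in>I. d i * x j * a i j) = (\<Sum>i\<in>I. \<Sum>j\<in>I. x i * d j * a i j)"
    by (subst sum.swap, intro sum.cong refl) (simp add: sym)
  have 3: "(\<Sum>i\<in>I. \<Sum>j\<in>I. d i * d j * a i j) = t\<^sup>2 * a l l"
  proof -
    have "(\<Sum>j\<in>I. d i * d j * a i j) = d i * t * a i l" for i
      using assms(1,2) by (subst sum.remove[of I l]) (auto simp: d_def)
    then show ?thesis
      using assms(1,2) by (simp, subst sum.remove[of I l]) (auto simp: d_def power2_eq_square)
  qed
  have "quad_form I a (\<lambda>i. x i + d i) = quad_form I a x
      + (\<Sum>i\<in>I. \<Sum>j\<in>I. x i * d j * a i j) + (\<Sum>i\<in>I. \<Sum>j\<in>I. d i * x j * a i j)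
      + (\<Sum>i\<in>I. \<Sum>j\<in>I. d i * d j * a i j)"
    unfolding quad_form_def sum.distrib[symmetric] by (intro sum.cong refl) (simp add: algebra_simps)
  then show ?thesis
    unfolding 2 unfolding 1 3 by (simp add: d_def)
qed

lemma psd_on_diag_nonneg:
  assumes "psd_on I a" "finite I" "l \<in> I"
  shows "0 \<le> a l l"
  using psd_on_quad_form[OF assms(1), of "\<lambda>i. 0 + (if i = l then 1 else 0)"]
    quad_form_shift[of I l a "\<lambda>_. 0" 1] psd_on_sym[OF assms(1)] assms(2,3)
  by (simp add: quad_form_def)

text \<open>The form of the Schur complement at \<open>x\<close> is the form of \<open>a\<close> at the vector obtained from \<open>x\<close> by
  moving its \<open>l\<close>-th coordinate to the minimiser of the form.\<close>

lemma schur_complement_psd: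
  assumes "psd_on I a" "finite I" "l \<in> I" "0 < a l l"
  shows "psd_on I (\<lambda>i j. a i j - a i l * a j l / a l l)"
proof (rule psd_onI)
  show "a i j - a i l * a j l / a l l = a j i - a j l * a i l / a l l" if "i \<in> I" "j \<in> I" for i j
    using psd_on_sym[OF assms(1) that] by simp
  fix x :: "'a \<Rightarrow> real"
  define s where "s = (\<Sum>i\<in>I. a i l * x i)"
  have "quad_form I (\<lambda>i j. a i j - a i l * a j l / a l l) x
      = quad_form I (\<lambda>i j. a i j - (1 / a l l) * (a i l * a j l)) x"
    by simp
  also have "\<dots> = quad_form I a x - s\<^sup>2 / a l l"
    unfolding quad_form_diff quad_form_scale quad_form_rank_one s_def by simp
  also have "\<dots> = quad_form I a x + 2 * (- s / a l l) * s + (- s / a l l)\<^sup>2 * a l l"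
    using assms(4) by (simp add: power2_eq_square field_simps)
  also have "\<dots> = quad_form I a (\<lambda>i. x i + (if i = l then - s / a l l else 0))"
    unfolding s_def
    by (rule quad_form_shift[symmetric]) (use assms(2,3) psd_on_sym[OF assms(1)] in auto)
  finally show "0 \<le> quad_form I (\<lambda>i j. a i j - a i l * a j l / a l l) x"
    using psd_on_quad_form[OF assms(1)] by simp
qed

text \<open>If \<open>a i l\<close> were nonzero for some \<open>i \<noteq> l\<close>, the form would be affine and nonconstant along
  the line through the \<open>i\<close>-th unit vector in direction \<open>l\<close>, hence negative somewhere.\<close>

lemma psd_on_zero_diag:
  assumes "psd_on I a" "finite I" "l \<in> I" "a l l = 0" "i \<in> I"
  shows "a i l = 0"
proof (cases "i = l")
  case True
  then show ?thesis using assms by simp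
next
  case False
  define e where "e k = (0::real) + (if k = i then 1 else 0)" for k
  have e: "quad_form I a e = a i i" "(\<Sum>k\<in>I. a k l * e k) = a i l"
    using quad_form_shift[of I i a "\<lambda>_. 0" 1] psd_on_sym[OF assms(1)] assms(2,5)
    by (simp_all add: e_def quad_form_def if_distrib[of "\<lambda>u. _ * u"] cong: if_cong)
  have "0 \<le> a i i + 2 * t * a i l" for t
    using psd_on_quad_form[OF assms(1), of "\<lambda>k. e k + (if k = l then t else 0)"]
      quad_form_shift[of I l a e t] psd_on_sym[OF assms(1)] assms(2-4) e by simp
  from this[of "- (a i i + 1) / (2 * a i l)"] show ?thesis
    by (cases "a i l = 0") (simp_all add: field_simps)
qed

text \<open>Split \<open>a\<close> into a rank-one matrix \<open>u u\<^sup>T\<close> and a Schur complement whose \<open>l\<close>-th row vanishes.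
  The product of \<open>u u\<^sup>T\<close> with \<open>b\<close> is a congruence of \<open>b\<close>, and the rest lives on fewer indices.\<close>

theorem schur_product:
  assumes "finite I" "psd_on I a" "psd_on I b"
  shows "psd_on I (\<lambda>i j. a i j * b i j)"
  using assms
proof (induction I arbitrary: a rule: finite_induct)
  case empty
  then show ?case by (simp add: psd_on_def quad_form_def)
next
  case (insert l I)
  let ?I = "insert l I"
  have fin: "finite ?I" and I: "?I - {l} = I" using insert.hyps by auto
  have b: "psd_on I b"
    using psd_on_subset[OF insert.prems(2)] fin by blast
  show ?case
  proof (rule psd_onI)
    show "a i j * b i j = a j i * b j i" if "i \<in> ?I" "j \<in> ?I" for i j
      using insert.prems psd_on_sym that by metis
    fix x :: "'a \<Rightarrow> real"
    have rest: "0 \<le> quad_form ?I (\<lambda>i j. c i j * b i j) x"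
      if c: "psd_on ?I c" and "\<And>i. i \<in> ?I \<Longrightarrow> c i l = 0" for c
    proof -
      have "c l i = 0" if "i \<in> ?I" for i
        using psd_on_sym[OF c, of l i] that \<open>\<And>i. i \<in> ?I \<Longrightarrow> c i l = 0\<close> by auto
      then have "quad_form ?I (\<lambda>i j. c i j * b i j) x = quad_form I (\<lambda>i j. c i j * b i j) x"
        using quad_form_zero_row[of ?I l "\<lambda>i j. c i j * b i j" x] fin that(2) I by auto
      moreover have "psd_on I c"
        using psd_on_subset[OF c] fin by blast
      ultimately show ?thesis
        using psd_on_quad_form[OF insert.IH[OF _ b]] by simp
    qed
    show "0 \<le> quad_form ?I (\<lambda>i j. a i j * b i j) x"
    proof (cases "a l l = 0")
      case True
      then show ?thesis
        using rest[of a] psd_on_zero_diag[OF insert.prems(1) fin] insert.prems(1) by blast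
    next
      case False
      then have pos: "0 < a l l"
        using psd_on_diag_nonneg[OF insert.prems(1) fin, of l] by auto
      define c where "c i j = a i j - a i l * a j l / a l l" for i j
      have "psd_on ?I c"
        unfolding c_def using schur_complement_psd[OF insert.prems(1) fin _ pos] by blast
      moreover have "c i l = 0" for i
        using pos by (simp add: c_def)
      ultimately have "0 \<le> quad_form ?I (\<lambda>i j. c i j * b i j) x"
        using rest by blast
      moreover have "0 \<le> quad_form ?I b (\<lambda>i. a i l * x i) / a l l"
        using psd_on_quad_form[OF insert.prems(2)] pos by simp
      moreover have "quad_form ?I (\<lambda>i j. a i j * b i j) x =
          quad_form ?I (\<lambda>i j. c i j * b i j) x + quad_form ?I b (\<lambda>i. a i l * x i) / a l l"
        unfolding quad_form_def sum_divide_distrib sum.distrib[symmetric]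
        using pos by (intro sum.cong refl) (simp add: c_def field_simps)
      ultimately show ?thesis by linarith
    qed
  qed
qed

section \<open>Extending positivity from rank one\<close>

definition preserves_psd_on :: "'i set \<Rightarrow> real \<Rightarrow> (real \<Rightarrow> real) \<Rightarrow> bool" where
  "preserves_psd_on I R f \<longleftrightarrow>
     (\<forall>a. psd_on I a \<longrightarrow> (\<forall>i\<in>I. \<forall>j\<in>I. a i j \<in> {0<..<R}) \<longrightarrow> psd_on I (\<lambda>i j. f (a i j)))"

lemma preserves_psd_onI:
  assumes "\<And>a x. psd_on I a \<Longrightarrow> (\<And>i j. i \<in> I \<Longrightarrow> j \<in> I \<Longrightarrow> a i j \<in> {0<..<R}) \<Longrightarrow>
             0 \<le> quad_form I (\<lambda>i j. f (a i j)) x"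
  shows "preserves_psd_on I R f"
  unfolding preserves_psd_on_def using assms by (auto intro!: psd_onI simp: psd_on_sym)

lemma preserves_psd_onD:
  assumes "preserves_psd_on I R f" "psd_on I a" "\<And>i j. i \<in> I \<Longrightarrow> j \<in> I \<Longrightarrow> a i j \<in> {0<..<R}"
  shows "psd_on I (\<lambda>i j. f (a i j))"
  using assms by (auto simp: preserves_psd_on_def)

text \<open>The extension principle of FitzGerald and Horn. Subtracting from \<open>a\<close> the rank-one matrix \<open>z z\<^sup>T\<close> that
  shares its \<open>l\<close>-th row leaves a positive semidefinite \<open>c\<close> with zero \<open>l\<close>-th row. Along the segment
  from \<open>z z\<^sup>T\<close> to \<open>a\<close> the form of the image under \<open>f\<close> has as derivative the form of \<open>c\<close> times
  the image under \<open>f'\<close>, entrywise; only the indices other than \<open>l\<close> matter there, so by the Schur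
  product theorem the form does not decrease along the segment. Hence positivity at the rank-one
  end is inherited by \<open>a\<close>.\<close>

theorem preserves_psd_from_derivative:
  assumes fin: "finite I" and l: "l \<in> I" and R: "0 < R"
    and deriv: "\<And>t. t \<in> {0<..<R} \<Longrightarrow> (f has_real_derivative f' t) (at t)"
    and f': "preserves_psd_on (I - {l}) R f'"
    and rank_one: "\<And>z x. (\<And>i. i \<in> I \<Longrightarrow> z i \<in> {0<..<sqrt R}) \<Longrightarrow>
                     0 \<le> quad_form I (\<lambda>i j. f (z i * z j)) x"
  shows "preserves_psd_on I R f"
proof (rule preserves_psd_onI)
  fix a and x :: "'a \<Rightarrow> real"
  assume a: "psd_on I a" and a_range: "\<And>i j. i \<in> I \<Longrightarrow> j \<in> I \<Longrightarrow> a i j \<in> {0<..<R}"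
  have pos: "0 < a l l" using a_range[OF l l] by simp
  \<comment> \<open>The rank-one matrix with the same \<open>l\<close>-th row as \<open>a\<close>.\<close>
  define z where "z i = a i l / sqrt (a l l)" for i
  define c where "c i j = a i j - z i * z j" for i j
  have z_mult: "z i * z j = a i l * a j l / a l l" for i j
    using pos by (simp add: z_def)
  have c: "psd_on I c"
    unfolding c_def z_mult by (rule schur_complement_psd[OF a fin l pos])
  have c_l: "c i l = 0" "c l i = 0" if "i \<in> I" for i
    using pos psd_on_sym[OF a that l] by (simp_all add: c_def z_mult)
  \<comment> \<open>The diagonal of the Schur complement bounds \<open>z\<close>, so the segment never leaves the range where
    \<open>f\<close> is differentiable.\<close>
  have z_range: "z i \<in> {0<..<sqrt R}" if "i \<in> I" for i
  proof -
    have "z i * z i \<le> a i i"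
      using psd_on_diag_nonneg[OF c fin that] by (simp add: c_def)
    then have "z i * z i < R" using a_range[OF that that] by simp
    then have "z i < sqrt R" by (simp add: power2_eq_square real_less_rsqrt)
    then show ?thesis using a_range[OF that l] pos by (simp add: z_def)
  qed
  define B where "B \<theta> i j = z i * z j + \<theta> * c i j" for \<theta> i j
  have B_conv: "B \<theta> i j = (1 - \<theta>) * (z i * z j) + \<theta> * a i j" for \<theta> i j
    by (simp add: B_def c_def algebra_simps)
  have B_range: "B \<theta> i j \<in> {0<..<R}" if "i \<in> I" "j \<in> I" "0 \<le> \<theta>" "\<theta> \<le> 1" for \<theta> i j
  proof -
    have z_pos: "0 < z i" "0 < z j" "z i < sqrt R" "z j < sqrt R"
      using z_range that by auto
    then have "z i * z j < sqrt R * sqrt R"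
      using R by (intro mult_strict_mono) auto
    then have zz: "0 < z i * z j" "z i * z j < R" using z_pos R by auto
    have aa: "0 < a i j" "a i j < R" using a_range that by auto
    have "0 < B \<theta> i j"
    proof (cases "\<theta> = 0")
      case False
      then have "0 < \<theta> * a i j" "0 \<le> (1 - \<theta>) * (z i * z j)" using that aa zz by auto
      then show ?thesis unfolding B_conv by linarith
    qed (use zz in \<open>simp add: B_def\<close>)
    moreover have "B \<theta> i j < R"
      unfolding B_conv using that aa zz by (intro convex_bound_lt) auto
    ultimately show ?thesis by simp
  qed
  have B_psd: "psd_on I (B \<theta>)" if "0 \<le> \<theta>" for \<theta>
  proof (rule psd_onI)
    show "B \<theta> i j = B \<theta> j i" if "i \<in> I" "j \<in> I" for i j
      using psd_on_sym[OF c that] by (simp add: B_def)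
    show "0 \<le> quad_form I (B \<theta>) x" for x
      unfolding B_def quad_form_add quad_form_rank_one quad_form_scale
      using psd_on_quad_form[OF c] that by simp
  qed
  define q where "q \<theta> = quad_form I (\<lambda>i j. f (B \<theta> i j)) x" for \<theta>
  have q': "(q has_real_derivative quad_form I (\<lambda>i j. c i j * f' (B \<theta> i j)) x) (at \<theta>)"
    if \<theta>: "0 \<le> \<theta>" "\<theta> \<le> 1" for \<theta>
  proof -
    have "((\<lambda>\<theta>. f (B \<theta> i j)) has_real_derivative f' (B \<theta> i j) * c i j) (at \<theta>)"
      if "i \<in> I" "j \<in> I" for i j
    proof (rule DERIV_chain2[where f = f])
      show "(f has_real_derivative f' (B \<theta> i j)) (at (B \<theta> i j))"
        using deriv B_range that \<theta> by blast
      show "((\<lambda>\<theta>. B \<theta> i j) has_real_derivative c i j) (at \<theta>)"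
        unfolding B_def by (auto intro!: derivative_eq_intros)
    qed
    then have "((\<lambda>\<theta>. x i * x j * f (B \<theta> i j)) has_real_derivative
        x i * x j * (c i j * f' (B \<theta> i j))) (at \<theta>)" if "i \<in> I" "j \<in> I" for i j
      using that by (auto intro!: DERIV_cmult simp: mult.commute)
    then show ?thesis
      unfolding q_def quad_form_def by (intro DERIV_sum) blast
  qed
  have q'_nonneg: "0 \<le> quad_form I (\<lambda>i j. c i j * f' (B \<theta> i j)) x" if \<theta>: "0 \<le> \<theta>" "\<theta> \<le> 1" for \<theta>
  proof -
    have "psd_on (I - {l}) (\<lambda>i j. f' (B \<theta> i j))"
      using f' psd_on_subset[OF B_psd _ fin] B_range \<theta> by (intro preserves_psd_onD[OF f']) auto
    moreover have "psd_on (I - {l}) c"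
      using psd_on_subset[OF c _ fin] by blast
    ultimately have "psd_on (I - {l}) (\<lambda>i j. c i j * f' (B \<theta> i j))"
      using schur_product fin by blast
    then show ?thesis
      using psd_on_quad_form quad_form_zero_row[OF fin l, of "\<lambda>i j. c i j * f' (B \<theta> i j)" x] c_l
      by fastforce
  qed
  have "q 0 \<le> q 1"
    by (rule DERIV_nonneg_imp_nondecreasing) (use q' q'_nonneg in auto)
  moreover have "0 \<le> q 0"
    using rank_one[of z x] z_range by (simp add: q_def B_def)
  ultimately show "0 \<le> quad_form I (\<lambda>i j. f (a i j)) x"
    by (simp add: q_def B_def c_def)
qed

section \<open>Interpolation by real powers\<close>

lemma rolle_finite_set:
  fixes h :: "real \<Rightarrow> real"
  assumes "finite X" "card X = Suc k"
    and root: "\<And>x. x \<in> X \<Longrightarrow> h x = 0"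
    and deriv: "\<And>x y t. x \<in> X \<Longrightarrow> y \<in> X \<Longrightarrow> x \<le> t \<Longrightarrow> t \<le> y \<Longrightarrow>
                  (h has_real_derivative h' t) (at t)"
  shows "\<exists>Y. finite Y \<and> card Y = k \<and> (\<forall>y\<in>Y. h' y = 0 \<and> (\<exists>a\<in>X. \<exists>b\<in>X. a < y \<and> y < b))"
  using assms
proof (induction X arbitrary: k rule: finite_linorder_max_induct)
  case empty
  then show ?case by simp
next
  case (insert b X)
  show ?case
  proof (cases k)
    case 0
    then show ?thesis by (intro exI[of _ "{}"]) simp
  next
    case (Suc m)
    have "b \<notin> X" using insert.hyps(2) by blast
    then have card: "card X = Suc m"
      using insert.prems(1) insert.hyps(1) Suc by simp
    then have "X \<noteq> {}" by auto
    define a where "a = Max X"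
    have a: "a \<in> X" "a < b" "\<And>x. x \<in> X \<Longrightarrow> x \<le> a"
      using insert.hyps \<open>X \<noteq> {}\<close> by (auto simp: a_def)
    have "\<exists>Y. finite Y \<and> card Y = m \<and>
        (\<forall>y\<in>Y. h' y = 0 \<and> (\<exists>a\<in>X. \<exists>b\<in>X. a < y \<and> y < b))"
      using insert.prems(2,3) by (intro insert.IH[OF card]) blast+
    then obtain Y where Y: "finite Y" "card Y = m"
      "\<forall>y\<in>Y. h' y = 0 \<and> (\<exists>a\<in>X. \<exists>b\<in>X. a < y \<and> y < b)"
      by blast
    have d: "(h has_real_derivative h' t) (at t)" if "a \<le> t" "t \<le> b" for t
      using insert.prems(3)[of a b t] a that by auto
    have "h a = h b"
      using insert.prems(2) a by simp
    moreover have "continuous_on {a..b} h"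
      using d by (auto intro!: continuous_at_imp_continuous_on DERIV_isCont)
    moreover have "\<And>x. a < x \<Longrightarrow> x < b \<Longrightarrow> h differentiable (at x)"
      using d real_differentiable_def by (metis less_imp_le)
    ultimately obtain y where y: "a < y" "y < b" "(h has_real_derivative 0) (at y)"
      using Rolle[OF a(2), of h] by auto
    then have "h' y = 0"
      using d[of y] DERIV_unique by force
    moreover have "y \<notin> Y"
      using Y(3) y(1) a(3) by force
    ultimately show ?thesis
      using Y y a(1) Suc by (intro exI[of _ "insert y Y"]) auto
  qed
qed

text \<open>Dividing \<open>x\<^sup>M - \<Sum> u\<^sub>i x\<^bsup>e i\<^esup>\<close> by its smallest power \<open>x\<^bsup>e k\<^esup>\<close> turns that term into a constant,
  which differentiation removes; Rolle's theorem costs one root. The result is an identity of the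
  same shape with one term and one point fewer, which drives both inductions below.\<close>

lemma rolle_power_sum:
  fixes e :: "'j \<Rightarrow> real"
  assumes "finite J" "k \<in> J" and M: "e k < M"
    and X: "finite X" "card X = Suc m" "X \<subseteq> {0<..<R}"
    and eq: "\<And>x. x \<in> X \<Longrightarrow> x powr M = (\<Sum>i\<in>J. u i * x powr e i)"
  shows "\<exists>Y. finite Y \<and> card Y = m \<and> Y \<subseteq> {0<..<R} \<and> (\<forall>y\<in>Y.
           y powr (M - e k - 1) =
           (\<Sum>i\<in>J - {k}. u i * (e i - e k) / (M - e k) * y powr (e i - e k - 1)))"
proof -
  define h where "h x = x powr (M - e k) - (\<Sum>i\<in>J. u i * x powr (e i - e k))" for x
  define h' where "h' x = (M - e k) * x powr (M - e k - 1)
      - (\<Sum>i\<in>J. u i * ((e i - e k) * x powr (e i - e k - 1)))" for x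
  have "(h has_real_derivative h' t) (at t)" if "0 < t" for t
    unfolding h_def h'_def using that
    by (intro DERIV_diff DERIV_sum DERIV_cmult has_real_derivative_powr)
  then have deriv: "(h has_real_derivative h' t) (at t)" if "x \<in> X" "x \<le> t" for x t
    using X(3) that by force
  have root: "h x = 0" if "x \<in> X" for x
  proof -
    have "h x = (x powr M - (\<Sum>i\<in>J. u i * x powr e i)) / x powr e k"
      by (simp add: h_def powr_diff diff_divide_distrib sum_divide_distrib)
    then show ?thesis using eq[OF that] by simp
  qed
  have "\<exists>Y. finite Y \<and> card Y = m \<and>
      (\<forall>y\<in>Y. h' y = 0 \<and> (\<exists>a\<in>X. \<exists>b\<in>X. a < y \<and> y < b))"
    by (rule rolle_finite_set[OF X(1,2) root deriv])
  then obtain Y where Y: "finite Y" "card Y = m"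
    "\<And>y. y \<in> Y \<Longrightarrow> h' y = 0 \<and> (\<exists>a\<in>X. \<exists>b\<in>X. a < y \<and> y < b)"
    by blast
  have "y powr (M - e k - 1) =
      (\<Sum>i\<in>J - {k}. u i * (e i - e k) / (M - e k) * y powr (e i - e k - 1))" if "y \<in> Y" for y
  proof -
    have "(M - e k) * y powr (M - e k - 1)
        = (\<Sum>i\<in>J - {k}. u i * ((e i - e k) * y powr (e i - e k - 1)))"
      using Y(3)[OF that] assms(1,2) by (simp add: h'_def sum.remove[of J k])
    then show ?thesis
      using M by (simp add: field_simps sum_divide_distrib[symmetric])
  qed
  moreover have "Y \<subseteq> {0<..<R}"
    using Y(3) X(3) by (meson greaterThanLessThan_iff less_trans subset_iff)
  ultimately show ?thesis using Y by blast
qed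

lemma ex_smallest_exponent:
  fixes e :: "'j \<Rightarrow> real"
  assumes "finite J" "J \<noteq> {}" "inj_on e J"
  shows "\<exists>k\<in>J. \<forall>i\<in>J - {k}. e k < e i"
proof -
  have "Min (e ` J) \<in> e ` J" using assms(1,2) by simp
  then obtain k where k: "k \<in> J" "e k = Min (e ` J)" by auto
  have "e k < e i" if "i \<in> J - {k}" for i
  proof -
    have "e k \<le> e i" using that assms(1) by (simp add: k(2))
    moreover have "e k \<noteq> e i" using that k(1) assms(3) by (auto dest: inj_onD)
    ultimately show ?thesis by simp
  qed
  then show ?thesis using k(1) by blast
qed

text \<open>The part of Descartes' rule of signs that gives uniqueness of interpolation: a nonzero combination
  of \<open>r\<close> distinct real powers has fewer than \<open>r\<close> positive roots.\<close>

lemma power_sum_few_roots: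
  fixes e :: "'j \<Rightarrow> real"
  assumes "finite J" "inj_on e J" "\<And>i. i \<in> J \<Longrightarrow> e i < M"
    and "finite X" "card X = Suc (card J)" "X \<subseteq> {0<..<R}"
  shows "\<exists>x\<in>X. x powr M \<noteq> (\<Sum>i\<in>J. u i * x powr e i)"
  using assms
proof (induction "card J" arbitrary: J e M X u)
  case 0
  then obtain x where "x \<in> X" by (metis card.empty ex_in_conv nat.distinct(1))
  moreover have "J = {}" using 0 by simp
  moreover have "0 < x" using 0 \<open>x \<in> X\<close> by auto
  ultimately show ?case by (intro bexI[of _ x]) auto
next
  case (Suc m)
  then have "J \<noteq> {}" by auto
  then obtain k where k: "k \<in> J" "\<And>i. i \<in> J - {k} \<Longrightarrow> e k < e i"
    using ex_smallest_exponent Suc.prems by metis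
  show ?case
  proof (rule ccontr)
    assume "\<not> ?thesis"
    then obtain Y where Y: "finite Y" "card Y = card J" "Y \<subseteq> {0<..<R}"
      "\<And>y. y \<in> Y \<Longrightarrow> y powr (M - e k - 1) =
           (\<Sum>i\<in>J - {k}. u i * (e i - e k) / (M - e k) * y powr (e i - e k - 1))"
      using rolle_power_sum[of J k e M X "card J" R u] Suc.prems k by auto
    have "\<exists>y\<in>Y. y powr (M - e k - 1) \<noteq>
           (\<Sum>i\<in>J - {k}. u i * (e i - e k) / (M - e k) * y powr (e i - e k - 1))"
    proof (rule Suc.hyps(1))
      show "m = card (J - {k})" "card Y = Suc (card (J - {k}))"
        using Suc.hyps(2) Suc.prems(1) Y(2) k(1) by simp_all
      show "inj_on (\<lambda>i. e i - e k - 1) (J - {k})"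
        using Suc.prems(2) by (auto simp: inj_on_def)
    qed (use Suc.prems Y in auto)
    then show False using Y(4) by blast
  qed
qed

text \<open>Newton's scheme: add the points one at a time, correcting by a combination \<open>\<phi>\<close> that vanishes at
  all earlier points; it cannot vanish at the new one because it would then have too many roots.\<close>

lemma interpolation_exists:
  fixes e :: "'j \<Rightarrow> real"
  assumes "finite J" "inj_on e J" "finite X" "card X = card J" "X \<subseteq> {0<..}"
  shows "\<exists>u. \<forall>x\<in>X. F x = (\<Sum>i\<in>J. u i * x powr e i)"
  using assms
proof (induction "card J" arbitrary: J X F)
  case 0
  then show ?case by auto
next
  case (Suc m)
  then have "J \<noteq> {}" "inj_on (\<lambda>i. - e i) J" by (auto simp: inj_on_def)
  then obtain k where k: "k \<in> J" "\<And>i. i \<in> J - {k} \<Longrightarrow> e i < e k"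
    using ex_smallest_exponent[of J "\<lambda>i. - e i"] Suc.prems by auto
  have "X \<noteq> {}" using Suc by auto
  then obtain x where x: "x \<in> X" by blast
  have IH: "\<exists>u. \<forall>y\<in>X - {x}. G y = (\<Sum>i\<in>J - {k}. u i * y powr e i)" for G
    using Suc.hyps(2) Suc.prems x k(1) by (intro Suc.hyps(1)) (auto intro: inj_on_subset)
  obtain u where u: "\<And>y. y \<in> X - {x} \<Longrightarrow> F y = (\<Sum>i\<in>J - {k}. u i * y powr e i)"
    using IH[of F] by blast
  obtain v where v: "\<And>y. y \<in> X - {x} \<Longrightarrow> y powr e k = (\<Sum>i\<in>J - {k}. v i * y powr e i)"
    using IH[of "\<lambda>y. y powr e k"] by blast
  \<comment> \<open>\<open>\<phi>\<close> vanishes at every point except \<open>x\<close>.\<close>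
  define \<phi> where "\<phi> y = y powr e k - (\<Sum>i\<in>J - {k}. v i * y powr e i)" for y
  have "\<exists>y\<in>X. y powr e k \<noteq> (\<Sum>i\<in>J - {k}. v i * y powr e i)"
  proof (rule power_sum_few_roots[where R = "Max X + 1"])
    show "card X = Suc (card (J - {k}))"
      using Suc.prems k(1) Suc.hyps(2) by simp
    show "X \<subseteq> {0<..<Max X + 1}"
      using Suc.prems(3,5) by (auto simp: less_add_one le_less_trans[OF Max_ge])
  qed (use Suc.prems k(2) in \<open>auto intro: inj_on_subset\<close>)
  then have x0: "\<phi> x \<noteq> 0"
    using v unfolding \<phi>_def by (metis DiffI eq_iff_diff_eq_0 singletonD)
  define r where "r = (F x - (\<Sum>i\<in>J - {k}. u i * x powr e i)) / \<phi> x"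
  define w where "w i = (if i = k then r else u i - r * v i)" for i
  have w: "(\<Sum>i\<in>J. w i * y powr e i) = (\<Sum>i\<in>J - {k}. u i * y powr e i) + r * \<phi> y" for y
  proof -
    have "(\<Sum>i\<in>J - {k}. w i * y powr e i) = (\<Sum>i\<in>J - {k}. (u i - r * v i) * y powr e i)"
      by (intro sum.cong) (auto simp: w_def)
    then have "(\<Sum>i\<in>J. w i * y powr e i)
        = r * y powr e k + (\<Sum>i\<in>J - {k}. (u i - r * v i) * y powr e i)"
      using Suc.prems(1) k(1) by (simp add: sum.remove[of J k] w_def)
    then show ?thesis
      by (simp add: \<phi>_def algebra_simps sum_subtractf sum_distrib_left)
  qed
  have "F y = (\<Sum>i\<in>J. w i * y powr e i)" if "y \<in> X" for y
  proof (cases "y = x")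
    case True
    then show ?thesis using x0 unfolding w r_def by simp
  next
    case False
    then have "\<phi> y = 0" using v that by (simp add: \<phi>_def)
    then show ?thesis using u that False unfolding w by simp
  qed
  then show ?case by blast
qed

text \<open>The coefficients that interpolate \<open>x\<^sup>M\<close> stay bounded however close together the points are, and
  however close to zero. All coefficients except that of the smallest power are bounded by induction,
  as they survive division and differentiation; the remaining one is then read off at any one
  interpolation point, where after division every exponent is positive.\<close>

lemma interpolation_coefficients_bounded:
  fixes e :: "'j \<Rightarrow> real"
  assumes "finite J" "inj_on e J" "\<And>i. i \<in> J \<Longrightarrow> e i < M"
  shows "\<exists>C. \<forall>u X. finite X \<longrightarrow> card X = card J \<longrightarrow> X \<subseteq> {0<..<R} \<longrightarrow>
           (\<forall>x\<in>X. x powr M = (\<Sum>i\<in>J. u i * x powr e i)) \<longrightarrow> (\<forall>i\<in>J. \<bar>u i\<bar> \<le> C)"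
  using assms
proof (induction "card J" arbitrary: J e M)
  case 0
  then show ?case by simp
next
  case (Suc m)
  then have "J \<noteq> {}" by auto
  then obtain k where k: "k \<in> J" "\<And>i. i \<in> J - {k} \<Longrightarrow> e k < e i"
    using ex_smallest_exponent Suc.prems by metis
  let ?J = "J - {k}"
  have M: "e k < M" using Suc.prems k by blast
  have card: "m = card ?J" "card J = Suc (card ?J)"
    using Suc.hyps(2) Suc.prems(1) k(1) by simp_all
  have "inj_on (\<lambda>i. e i - e k - 1) ?J"
    using Suc.prems(2) by (auto simp: inj_on_def)
  then have "\<exists>C. \<forall>u X. finite X \<longrightarrow> card X = card ?J \<longrightarrow> X \<subseteq> {0<..<R} \<longrightarrow>
      (\<forall>x\<in>X. x powr (M - e k - 1) = (\<Sum>i\<in>?J. u i * x powr (e i - e k - 1))) \<longrightarrow>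
      (\<forall>i\<in>?J. \<bar>u i\<bar> \<le> C)"
    by (rule Suc.hyps(1)[OF card(1) finite_Diff[OF Suc.prems(1)]]) (use Suc.prems(3) in auto)
  then obtain C where C: "\<forall>u X. finite X \<longrightarrow> card X = card ?J \<longrightarrow> X \<subseteq> {0<..<R} \<longrightarrow>
      (\<forall>x\<in>X. x powr (M - e k - 1) = (\<Sum>i\<in>?J. u i * x powr (e i - e k - 1))) \<longrightarrow>
      (\<forall>i\<in>?J. \<bar>u i\<bar> \<le> C)" ..
  \<comment> \<open>\<open>D\<close> undoes the scaling of the coefficients caused by differentiation; \<open>E\<close> bounds the coefficient
    of the smallest power.\<close>
  define D where "D i = C * (M - e k) / (e i - e k)" for i
  define E where "E = R powr (M - e k) + (\<Sum>i\<in>?J. D i * R powr (e i - e k))"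
  have bound: "\<bar>u i\<bar> \<le> (if i = k then E else D i)"
    if X: "finite X" "card X = card J" "X \<subseteq> {0<..<R}"
      and eq: "\<And>x. x \<in> X \<Longrightarrow> x powr M = (\<Sum>i\<in>J. u i * x powr e i)" and "i \<in> J" for u X i
  proof -
    have "\<exists>Y. finite Y \<and> card Y = card ?J \<and> Y \<subseteq> {0<..<R} \<and> (\<forall>y\<in>Y.
        y powr (M - e k - 1) =
        (\<Sum>i\<in>?J. u i * (e i - e k) / (M - e k) * y powr (e i - e k - 1)))"
      using X(2) card(2)
      by (intro rolle_power_sum[OF Suc.prems(1) k(1) M X(1) _ X(3) eq]) simp_all
    then obtain Y where Y: "finite Y" "card Y = card ?J" "Y \<subseteq> {0<..<R}"
      "\<forall>y\<in>Y. y powr (M - e k - 1) =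
           (\<Sum>i\<in>?J. u i * (e i - e k) / (M - e k) * y powr (e i - e k - 1))"
      by (elim exE conjE)
    have scaled: "\<forall>i\<in>?J. \<bar>u i * (e i - e k) / (M - e k)\<bar> \<le> C"
      by (rule C[THEN spec[of _ "\<lambda>i. u i * (e i - e k) / (M - e k)"], THEN spec[of _ Y],
            THEN mp, THEN mp, THEN mp, THEN mp, OF Y])
    have D: "\<bar>u i\<bar> \<le> D i" if "i \<in> ?J" for i
    proof -
      have "\<bar>u i\<bar> * (e i - e k) / (M - e k) \<le> C"
        using bspec[OF scaled that] k(2)[OF that] M by (simp add: abs_mult)
      then show ?thesis
        using k(2)[OF that] M by (simp add: D_def pos_le_divide_eq pos_divide_le_eq)
    qed
    obtain x where x: "x \<in> X" using X card by fastforce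
    then have x_range: "0 < x" "x < R" using X by auto
    have mono: "x powr s \<le> R powr s" if "0 \<le> s" for s
      using x_range that by (intro powr_mono2) auto
    have "x powr M = u k * x powr e k + (\<Sum>i\<in>?J. u i * x powr e i)"
      using eq[OF x] Suc.prems(1) k(1) by (simp add: sum.remove[of J k])
    then have "u k = x powr M / x powr e k - (\<Sum>i\<in>?J. u i * x powr e i) / x powr e k"
      using x_range by (simp add: field_simps)
    also have "\<dots> = x powr (M - e k) - (\<Sum>i\<in>?J. u i * x powr (e i - e k))"
      by (simp add: powr_diff sum_divide_distrib)
    finally have "\<bar>u k\<bar> \<le> \<bar>x powr (M - e k)\<bar> + \<bar>\<Sum>i\<in>?J. u i * x powr (e i - e k)\<bar>"
      by linarith
    also have "\<dots> \<le> R powr (M - e k) + (\<Sum>i\<in>?J. D i * R powr (e i - e k))"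
    proof (rule add_mono)
      have "\<bar>\<Sum>i\<in>?J. u i * x powr (e i - e k)\<bar> \<le> (\<Sum>i\<in>?J. \<bar>u i * x powr (e i - e k)\<bar>)"
        by (rule sum_abs)
      also have "\<dots> \<le> (\<Sum>i\<in>?J. D i * R powr (e i - e k))"
      proof (rule sum_mono)
        fix i assume i: "i \<in> ?J"
        have "0 \<le> D i" using D[OF i] by linarith
        then show "\<bar>u i * x powr (e i - e k)\<bar> \<le> D i * R powr (e i - e k)"
          unfolding abs_mult using D[OF i] mono[of "e i - e k"] k(2)[OF i]
          by (intro mult_mono) auto
      qed
      finally show "\<bar>\<Sum>i\<in>?J. u i * x powr (e i - e k)\<bar> \<le> (\<Sum>i\<in>?J. D i * R powr (e i - e k))" .
    qed (use mono M in auto)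
    finally have "\<bar>u k\<bar> \<le> E" by (simp add: E_def)
    then show ?thesis using D \<open>i \<in> J\<close> by auto
  qed
  define B where "B i = (if i = k then E else D i)" for i
  have B: "B i \<le> (\<Sum>i\<in>J. \<bar>B i\<bar>)" if "i \<in> J" for i
    using member_le_sum[of i J "\<lambda>i. \<bar>B i\<bar>"] that Suc.prems(1)
    by (auto intro: order_trans[OF abs_ge_self])
  show ?case
  proof (intro exI[of _ "\<Sum>i\<in>J. \<bar>B i\<bar>"] allI impI ballI)
    fix u X i
    assume "finite X" "card X = card J" "X \<subseteq> {0<..<R}"
      "\<forall>x\<in>X. x powr M = (\<Sum>i\<in>J. u i * x powr e i)" "i \<in> J"
    then have "\<bar>u i\<bar> \<le> B i"
      unfolding B_def by (intro bound[of X]) auto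
    then show "\<bar>u i\<bar> \<le> (\<Sum>i\<in>J. \<bar>B i\<bar>)"
      using B[OF \<open>i \<in> J\<close>] by linarith
  qed
qed

section \<open>Entrywise powers and their domination\<close>

lemma preserves_psd_on_add:
  assumes "preserves_psd_on I R f" "preserves_psd_on I R g"
  shows "preserves_psd_on I R (\<lambda>t. f t + g t)"
  by (rule preserves_psd_onI)
    (simp add: quad_form_add psd_on_quad_form preserves_psd_onD[OF assms(1)] preserves_psd_onD[OF assms(2)])

lemma preserves_psd_on_scale:
  assumes "preserves_psd_on I R f" "0 \<le> c"
  shows "preserves_psd_on I R (\<lambda>t. c * f t)"
  by (rule preserves_psd_onI)
    (simp add: quad_form_scale psd_on_quad_form preserves_psd_onD[OF assms(1)] assms(2))

lemma preserves_psd_on_sum: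
  assumes "\<And>k. k \<in> K \<Longrightarrow> preserves_psd_on I R (f k)"
  shows "preserves_psd_on I R (\<lambda>t. \<Sum>k\<in>K. f k t)"
  by (rule preserves_psd_onI)
    (auto simp: quad_form_sum intro!: sum_nonneg psd_on_quad_form preserves_psd_onD[OF assms])

lemma preserves_psd_on_singleton:
  assumes "\<And>t. t \<in> {0<..<R} \<Longrightarrow> 0 \<le> f t"
  shows "preserves_psd_on {l} R f"
  using assms by (intro preserves_psd_onI) (auto simp: quad_form_def)

text \<open>By a theorem of FitzGerald and Horn these are, when \<open>N \<ge> 2\<close>, exactly the exponents whose powers
  preserve positivity on \<open>N\<close> by \<open>N\<close> matrices with positive entries. The set is adapted to the extension
  principle: differentiation lowers the exponent and the size both by one.\<close>

definition preserving_exponent :: "nat \<Rightarrow> real \<Rightarrow> bool" where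
  "preserving_exponent N \<alpha> \<longleftrightarrow> \<alpha> \<in> \<nat> \<union> {real N - 2..}"

lemma preserving_exponent_nonneg: "preserving_exponent N \<alpha> \<Longrightarrow> 2 \<le> N \<Longrightarrow> 0 \<le> \<alpha>"
  by (auto simp: preserving_exponent_def elim!: Nats_cases)

lemma preserving_exponent_minus_one:
  assumes "preserving_exponent (Suc N) \<alpha>" "\<alpha> \<noteq> 0"
  shows "preserving_exponent N (\<alpha> - 1)"
  using assms by (auto simp: preserving_exponent_def elim!: Nats_cases intro!: Nats_diff)

lemma quad_form_rank_one_powr:
  "quad_form I (\<lambda>i j. (z i * z j) powr \<alpha>) x = (\<Sum>i\<in>I. z i powr \<alpha> * x i)\<^sup>2"
  by (simp add: powr_mult quad_form_rank_one)

lemma powr_derivative_preserves_psd: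
  assumes "0 \<le> \<alpha>" "\<alpha> \<noteq> 0 \<Longrightarrow> preserves_psd_on I R (\<lambda>t. t powr (\<alpha> - 1))"
  shows "preserves_psd_on I R (\<lambda>t. \<alpha> * t powr (\<alpha> - 1))"
proof (cases "\<alpha> = 0")
  case True
  then show ?thesis by (simp add: preserves_psd_onI quad_form_def)
qed (use assms preserves_psd_on_scale in blast)

theorem powr_preserves_psd:
  assumes "finite I" "card I = Suc m" "preserving_exponent (Suc m) \<alpha>" "0 < R"
  shows "preserves_psd_on I R (\<lambda>t. t powr \<alpha>)"
  using assms
proof (induction m arbitrary: I \<alpha>)
  case 0
  then obtain l where "I = {l}" by (auto simp: card_1_singleton_iff)
  then show ?case by (auto intro: preserves_psd_on_singleton)
next
  case (Suc m)
  then obtain l where l: "l \<in> I" by (metis card.empty ex_in_conv nat.distinct(1))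
  have \<alpha>: "0 \<le> \<alpha>" using preserving_exponent_nonneg[OF Suc.prems(3)] by simp
  show ?case
  proof (rule preserves_psd_from_derivative[OF Suc.prems(1) l Suc.prems(4)])
    show "((\<lambda>t. t powr \<alpha>) has_real_derivative \<alpha> * t powr (\<alpha> - 1)) (at t)"
      if "t \<in> {0<..<R}" for t
      using that by (intro has_real_derivative_powr) auto
    show "preserves_psd_on (I - {l}) R (\<lambda>t. \<alpha> * t powr (\<alpha> - 1))"
      using Suc.prems l \<alpha>
      by (intro powr_derivative_preserves_psd Suc.IH preserving_exponent_minus_one) auto
    show "0 \<le> quad_form I (\<lambda>i j. (z i * z j) powr \<alpha>) x" for z x
      unfolding quad_form_rank_one_powr by simp
  qed
qed

text \<open>On rank-one matrices the form of the entrywise power is a square \<open>\<langle>z\<^sup>M, x\<rangle>\<^sup>2\<close>. Since the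
  vector \<open>z\<close> has at most \<open>card J\<close> distinct entries, its power \<open>z\<^sup>M\<close> is a combination of the \<open>z\<^bsup>e k\<^esup>\<close> with
  bounded coefficients, and the Cauchy--Schwarz inequality applies.\<close>

lemma rank_one_domination:
  fixes e :: "'j \<Rightarrow> real"
  assumes J: "finite J" "inj_on e J" and M: "\<And>k. k \<in> J \<Longrightarrow> e k < M" and R: "0 < R"
  shows "\<exists>C\<ge>0. \<forall>(I :: 'i set) z x. finite I \<longrightarrow> card I = card J \<longrightarrow> (\<forall>i\<in>I. z i \<in> {0<..<R}) \<longrightarrow>
           quad_form I (\<lambda>i j. (z i * z j) powr M) x
             \<le> C * (\<Sum>k\<in>J. quad_form I (\<lambda>i j. (z i * z j) powr e k) x)"
proof -
  obtain C where C: "\<forall>u X. finite X \<longrightarrow> card X = card J \<longrightarrow> X \<subseteq> {0<..<R} \<longrightarrow>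
      (\<forall>x\<in>X. x powr M = (\<Sum>i\<in>J. u i * x powr e i)) \<longrightarrow> (\<forall>i\<in>J. \<bar>u i\<bar> \<le> C)"
    using interpolation_coefficients_bounded[OF J M] ..
  have "quad_form I (\<lambda>i j. (z i * z j) powr M) x
      \<le> (\<Sum>k\<in>J. C\<^sup>2) * (\<Sum>k\<in>J. quad_form I (\<lambda>i j. (z i * z j) powr e k) x)"
    if I: "finite I" "card I = card J" and z: "\<forall>i\<in>I. z i \<in> {0<..<R}"
    for I :: "'i set" and z x
  proof -
    have le: "card (z ` I) \<le> card J" using card_image_le[OF I(1)] I(2) by metis
    have "infinite ({0<..<R} - z ` I)"
      using I(1) R infinite_Ioo by (simp add: Diff_infinite_finite)
    \<comment> \<open>Repeated entries of \<open>z\<close> leave too few nodes, so fill up with arbitrary ones.\<close>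
    then obtain X' where X': "finite X'" "card X' = card J - card (z ` I)"
      "X' \<subseteq> {0<..<R} - z ` I"
      using infinite_arbitrarily_large by blast
    define X where "X = X' \<union> z ` I"
    have "card X = card X' + card (z ` I)"
      unfolding X_def using X' I(1) by (intro card_Un_disjoint) auto
    then have X: "finite X" "card X = card J" "X \<subseteq> {0<..<R}"
      using X' I le z by (auto simp: X_def)
    have "X \<subseteq> {0<..}" using X(3) by auto
    then obtain u where u: "\<forall>x\<in>X. x powr M = (\<Sum>i\<in>J. u i * x powr e i)"
      using interpolation_exists[OF J X(1,2), of "\<lambda>x. x powr M"] by blast
    have "\<forall>i\<in>J. \<bar>u i\<bar> \<le> C"
      by (rule C[THEN spec[of _ u], THEN spec[of _ X], THEN mp, THEN mp, THEN mp, THEN mp, OF X u])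
    then have u_sq: "(u i)\<^sup>2 \<le> C\<^sup>2" if "i \<in> J" for i
      using that by (metis abs_ge_zero power2_abs power_mono)
    have z_powr: "z i powr M = (\<Sum>k\<in>J. u k * z i powr e k)" if "i \<in> I" for i
      using u that by (simp add: X_def)
    define v where "v k = (\<Sum>i\<in>I. z i powr e k * x i)" for k
    have "(\<Sum>i\<in>I. z i powr M * x i) = (\<Sum>i\<in>I. \<Sum>k\<in>J. u k * (z i powr e k * x i))"
      using z_powr by (simp add: sum_distrib_right mult.assoc)
    also have "\<dots> = (\<Sum>k\<in>J. u k * v k)"
      unfolding v_def sum_distrib_left by (rule sum.swap)
    finally have "quad_form I (\<lambda>i j. (z i * z j) powr M) x = (\<Sum>k\<in>J. u k * v k)\<^sup>2"
      unfolding quad_form_rank_one_powr by simp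
    also have "\<dots> \<le> (\<Sum>k\<in>J. (u k)\<^sup>2) * (\<Sum>k\<in>J. (v k)\<^sup>2)"
      by (rule Cauchy_Schwarz_ineq_sum)
    also have "\<dots> \<le> (\<Sum>k\<in>J. C\<^sup>2) * (\<Sum>k\<in>J. (v k)\<^sup>2)"
      using u_sq by (intro mult_right_mono sum_mono sum_nonneg) auto
    finally show ?thesis
      unfolding quad_form_rank_one_powr v_def .
  qed
  then show ?thesis by (intro exI[of _ "\<Sum>k\<in>J. C\<^sup>2"]) (auto intro: sum_nonneg)
qed

text \<open>Among the exponents admitted for size \<open>N\<close>, a higher power is dominated by any \<open>N\<close> lower ones, with one
  constant for all \<open>N\<close> by \<open>N\<close> matrices with entries in \<open>(0, R)\<close>. Rank one is the previous lemma; the extension principle reduces the general case to the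
  derivative, where one of the lower powers may be discarded because its derivative preserves
  positivity by itself or vanishes, leaving the claim for size \<open>N - 1\<close>.\<close>

theorem power_domination:
  fixes e :: "'j \<Rightarrow> real" and I :: "'i set"
  assumes "finite I" "card I = Suc m" "finite J" "card J = Suc m" "inj_on e J"
    and "\<And>k. k \<in> J \<Longrightarrow> preserving_exponent (Suc m) (e k)" "preserving_exponent (Suc m) M"
    and "\<And>k. k \<in> J \<Longrightarrow> e k < M" and "0 < R"
  shows "\<exists>C\<ge>0. preserves_psd_on I R (\<lambda>t. C * (\<Sum>k\<in>J. t powr e k) - t powr M)"
  using assms
proof (induction m arbitrary: I J e M)
  case 0
  then obtain l k where lk: "I = {l}" "J = {k}" by (auto simp: card_1_singleton_iff)
  have "t powr M \<le> R powr (M - e k) * t powr e k" if "0 < t" "t < R" for t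
  proof -
    have "t powr M = t powr (M - e k) * t powr e k" using that by (simp flip: powr_add)
    also have "\<dots> \<le> R powr (M - e k) * t powr e k"
      using that 0(8)[of k] lk by (intro mult_right_mono powr_mono2) auto
    finally show ?thesis .
  qed
  then show ?case
    unfolding lk by (intro exI[of _ "R powr (M - e k)"] conjI preserves_psd_on_singleton) auto
next
  case (Suc m)
  note fin = Suc.prems(1,3) and R = Suc.prems(9)
  obtain l where l: "l \<in> I" using Suc.prems(2) by fastforce
  obtain k where k: "k \<in> J" "\<And>i. i \<in> J - {k} \<Longrightarrow> e k < e i"
    using ex_smallest_exponent[OF Suc.prems(3) _ Suc.prems(5)] Suc.prems(4) by fastforce
  let ?J = "J - {k}"
  have card: "finite (I - {l})" "card (I - {l}) = Suc m" "finite ?J" "card ?J = Suc m"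
    using Suc.prems(1-4) l k(1) by simp_all
  have e0: "0 \<le> e i" if "i \<in> J" for i
    using preserving_exponent_nonneg[OF Suc.prems(6)[OF that]] by simp
  have e_pos: "0 < e i" if "i \<in> ?J" for i
    using k(2)[OF that] e0[OF k(1)] by linarith
  have M: "0 < M" using Suc.prems(8)[OF k(1)] e0[OF k(1)] by linarith
  have "\<exists>C\<ge>0. preserves_psd_on (I - {l}) R
      (\<lambda>t. C * (\<Sum>i\<in>?J. t powr (e i - 1)) - t powr (M - 1))"
  proof (rule Suc.IH[OF card])
    show "inj_on (\<lambda>i. e i - 1) ?J"
      using Suc.prems(5) by (auto simp: inj_on_def)
    show "preserving_exponent (Suc m) (e i - 1)" if "i \<in> ?J" for i
      using Suc.prems(6) e_pos[OF that] that by (intro preserving_exponent_minus_one) auto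
    show "preserving_exponent (Suc m) (M - 1)"
      using Suc.prems(7) M by (intro preserving_exponent_minus_one) auto
  qed (use Suc.prems(8) R in auto)
  then obtain C' where C': "0 \<le> C'" "preserves_psd_on (I - {l}) R
      (\<lambda>t. C' * (\<Sum>i\<in>?J. t powr (e i - 1)) - t powr (M - 1))" by blast
  have "\<exists>C\<ge>0. \<forall>(I :: 'i set) z x. finite I \<longrightarrow> card I = card J \<longrightarrow>
      (\<forall>i\<in>I. z i \<in> {0<..<sqrt R}) \<longrightarrow>
      quad_form I (\<lambda>i j. (z i * z j) powr M) x
        \<le> C * (\<Sum>k\<in>J. quad_form I (\<lambda>i j. (z i * z j) powr e k) x)"
    using Suc.prems R by (intro rank_one_domination) auto
  then obtain C1 where C1: "0 \<le> C1" "\<And>z x. \<forall>i\<in>I. z i \<in> {0<..<sqrt R} \<Longrightarrow>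
      quad_form I (\<lambda>i j. (z i * z j) powr M) x
        \<le> C1 * (\<Sum>k\<in>J. quad_form I (\<lambda>i j. (z i * z j) powr e k) x)"
    using Suc.prems(1,2,4) by metis
  \<comment> \<open>Large enough for rank one, and such that \<open>C * e i\<close> dominates \<open>M * C'\<close> after differentiation.\<close>
  define C where "C = C1 + (\<Sum>i\<in>?J. M * C' / e i)"
  have terms: "0 \<le> M * C' / e i" if "i \<in> ?J" for i
    using M C'(1) e_pos[OF that] by simp
  then have C_ge: "C1 \<le> C" "0 \<le> C"
    using C1(1) sum_nonneg[of ?J "\<lambda>i. M * C' / e i"] unfolding C_def by auto
  have C_deriv: "M * C' \<le> C * e i" if "i \<in> ?J" for i
  proof -
    have "M * C' / e i \<le> (\<Sum>i\<in>?J. M * C' / e i)"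
      using that terms card(3) by (intro member_le_sum) auto
    then have "M * C' / e i \<le> C" using C1(1) by (simp add: C_def)
    then show ?thesis using e_pos[OF that] by (simp add: pos_divide_le_eq)
  qed
  define f' where "f' t = C * (\<Sum>i\<in>J. e i * t powr (e i - 1)) - M * t powr (M - 1)" for t
  \<comment> \<open>The induction hypothesis accounts for the first summand; the others are single powers with
    nonnegative coefficients.\<close>
  have f'_split: "f' t = M * (C' * (\<Sum>i\<in>?J. t powr (e i - 1)) - t powr (M - 1))
      + (\<Sum>i\<in>?J. (C * e i - M * C') * t powr (e i - 1)) + C * (e k * t powr (e k - 1))" for t
    using fin(2) k(1)
    by (simp add: f'_def sum.remove[of J k] algebra_simps sum_subtractf sum_distrib_left)
  have "preserves_psd_on I R (\<lambda>t. C * (\<Sum>k\<in>J. t powr e k) - t powr M)"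
  proof (rule preserves_psd_from_derivative[OF fin(1) l R])
    show "((\<lambda>t. C * (\<Sum>k\<in>J. t powr e k) - t powr M) has_real_derivative f' t) (at t)"
      if "t \<in> {0<..<R}" for t
      unfolding f'_def using that
      by (intro DERIV_diff DERIV_cmult DERIV_sum has_real_derivative_powr) auto
    show "preserves_psd_on (I - {l}) R f'"
      unfolding f'_split
    proof (intro preserves_psd_on_add preserves_psd_on_sum)
      show "preserves_psd_on (I - {l}) R
          (\<lambda>t. M * (C' * (\<Sum>i\<in>?J. t powr (e i - 1)) - t powr (M - 1)))"
        using C'(2) M by (intro preserves_psd_on_scale) auto
      show "preserves_psd_on (I - {l}) R (\<lambda>t. (C * e i - M * C') * t powr (e i - 1))"
        if "i \<in> ?J" for i
        using C_deriv[OF that] e_pos[OF that] Suc.prems(6)[of i] that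
        by (intro preserves_psd_on_scale powr_preserves_psd[OF card(1,2) _ R]
            preserving_exponent_minus_one) auto
      show "preserves_psd_on (I - {l}) R (\<lambda>t. C * (e k * t powr (e k - 1)))"
        using C_ge(2) e0[OF k(1)] Suc.prems(6)[OF k(1)]
        by (intro preserves_psd_on_scale powr_derivative_preserves_psd
            powr_preserves_psd[OF card(1,2) _ R] preserving_exponent_minus_one) auto
    qed
    fix z x assume z: "\<And>i. i \<in> I \<Longrightarrow> z i \<in> {0<..<sqrt R}"
    have "quad_form I (\<lambda>i j. (z i * z j) powr M) x
        \<le> C1 * (\<Sum>k\<in>J. quad_form I (\<lambda>i j. (z i * z j) powr e k) x)"
      using C1(2) z by blast
    also have "\<dots> \<le> C * (\<Sum>k\<in>J. quad_form I (\<lambda>i j. (z i * z j) powr e k) x)"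
      using C_ge(1) by (intro mult_right_mono sum_nonneg) (simp_all add: quad_form_rank_one_powr)
    finally show "0 \<le> quad_form I (\<lambda>i j. C * (\<Sum>k\<in>J. (z i * z j) powr e k) - (z i * z j) powr M) x"
      by (simp add: quad_form_diff quad_form_scale quad_form_sum)
  qed
  then show ?case using C_ge(2) by blast
qed

section \<open>Hermitian matrices with positive entries\<close>

abbreviation real_mat :: "nat \<Rightarrow> (nat \<Rightarrow> nat \<Rightarrow> real) \<Rightarrow> complex mat" where
  "real_mat N a \<equiv> mat N N (\<lambda>(i, j). complex_of_real (a i j))"

text \<open>For a real symmetric matrix the Hermitian form at \<open>v\<close> is the sum of the real forms at the real and
  the imaginary part of \<open>v\<close>.\<close>

lemma hermitian_psd_real_mat: "hermitian_psd N (real_mat N a) \<longleftrightarrow> psd_on {..<N} a"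
proof -
  have adjoint: "mat_adjoint (real_mat N a) = real_mat N a \<longleftrightarrow> (\<forall>i<N. \<forall>j<N. a i j = a j i)"
    by (auto simp: mat_adjoint_def mat_eq_iff mat_of_rows_index)
  have form: "Re ((real_mat N a *\<^sub>v v) \<bullet>c v)
      = quad_form {..<N} a (\<lambda>i. Re (v $ i)) + quad_form {..<N} a (\<lambda>i. Im (v $ i))"
    if "v \<in> carrier_vec N" for v
  proof -
    have "(real_mat N a *\<^sub>v v) \<bullet>c v
        = (\<Sum>i<N. (\<Sum>j<N. complex_of_real (a i j) * v $ j) * cnj (v $ i))"
      unfolding scalar_prod_def using that by (auto simp: scalar_prod_def atLeast0LessThan intro!: sum.cong)
    also have "Re \<dots> = (\<Sum>i<N. \<Sum>j<N. Re (complex_of_real (a i j) * v $ j * cnj (v $ i)))"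
      by (simp only: Re_sum sum_distrib_right)
    also have "\<dots> = (\<Sum>i<N. \<Sum>j<N. Re (v $ i) * Re (v $ j) * a i j
        + Im (v $ i) * Im (v $ j) * a i j)"
      by (intro sum.cong refl) (simp add: algebra_simps)
    finally show ?thesis
      by (simp only: quad_form_def sum.distrib)
  qed
  have "(\<forall>v\<in>carrier_vec N. 0 \<le> Re ((real_mat N a *\<^sub>v v) \<bullet>c v))
      \<longleftrightarrow> (\<forall>x. 0 \<le> quad_form {..<N} a x)"
  proof
    assume nonneg: "\<forall>v\<in>carrier_vec N. 0 \<le> Re ((real_mat N a *\<^sub>v v) \<bullet>c v)"
    show "\<forall>x. 0 \<le> quad_form {..<N} a x"
    proof
      fix x
      define v where "v = vec N (\<lambda>i. complex_of_real (x i))"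
      have "quad_form {..<N} a (\<lambda>i. Re (v $ i)) = quad_form {..<N} a x"
        "quad_form {..<N} a (\<lambda>i. Im (v $ i)) = 0"
        by (simp_all add: v_def quad_form_def)
      moreover have "v \<in> carrier_vec N" by (simp add: v_def)
      ultimately show "0 \<le> quad_form {..<N} a x"
        using nonneg form by (metis add.right_neutral)
    qed
  qed (simp add: form)
  then show ?thesis
    unfolding hermitian_psd_def psd_on_def adjoint by auto
qed

lemma entrywise_positivity_preserver_of_real:
  assumes "preserves_psd_on {..<N} \<rho> g"
  shows "entrywise_positivity_preserver (\<lambda>z. complex_of_real (g (Re z))) N
           (complex_of_real ` {0<..<\<rho>})"
  unfolding entrywise_positivity_preserver_def
proof
  fix A assume A: "A \<in> psd_matrices N (complex_of_real ` {0<..<\<rho>})"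
  then have dim: "A \<in> carrier_mat N N" by (simp add: psd_matrices_def hermitian_psd_def)
  define a where "a i j = Re (A $$ (i, j))" for i j
  have entry: "a i j \<in> {0<..<\<rho>} \<and> A $$ (i, j) = complex_of_real (a i j)" if "i < N" "j < N" for i j
  proof -
    have "A $$ (i, j) \<in> complex_of_real ` {0<..<\<rho>}"
      using A elements_matI[OF dim that refl] by (auto simp: psd_matrices_def)
    then show ?thesis by (auto simp: a_def)
  qed
  then have "A = real_mat N a"
    using dim by (intro eq_matI) auto
  then have "psd_on {..<N} a"
    using A hermitian_psd_real_mat by (simp add: psd_matrices_def)
  then have "psd_on {..<N} (\<lambda>i j. g (a i j))"
    using entry by (intro preserves_psd_onD[OF assms]) auto
  moreover have "map_mat (\<lambda>z. complex_of_real (g (Re z))) A = real_mat N (\<lambda>i j. g (a i j))"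
    using dim by (intro eq_matI) (auto simp: a_def)
  ultimately show "hermitian_psd N (map_mat (\<lambda>z. complex_of_real (g (Re z))) A)"
    by (simp add: hermitian_psd_real_mat)
qed

lemma quad_form_sums:
  assumes "finite I" "\<And>i j. i \<in> I \<Longrightarrow> j \<in> I \<Longrightarrow> (\<lambda>k. h k (a i j)) sums g (a i j)"
  shows "(\<lambda>k. quad_form I (\<lambda>i j. h k (a i j)) x) sums quad_form I (\<lambda>i j. g (a i j)) x"
  unfolding quad_form_def using assms by (intro sums_sum sums_mult) auto

text \<open>The positive terms have a total form \<open>Q\<close>, and the \<open>i\<close>-th other term is worth at least
  \<open>- Q / 2\<^bsup>i+2\<^esup>\<close> by hypothesis. These losses add up to at most \<open>Q / 2\<close>. Each loss is compared
  with the whole of \<open>Q\<close>, so the sets \<open>S\<close> may overlap and no rearrangement of the series occurs.\<close>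

theorem series_preserves_psd:
  fixes n p b :: "nat \<Rightarrow> real"
  assumes fin: "finite I"
    and powers: "\<And>i. preserves_psd_on I \<rho> (\<lambda>t. t powr n i)"
    and p: "\<And>i. 0 \<le> p i"
    and summable_p: "\<And>t. t \<in> {0<..<\<rho>} \<Longrightarrow> summable (\<lambda>i. p i * t powr n i)"
    and b_le: "\<And>i. \<bar>b i\<bar> \<le> p i"
    and b_P: "\<And>i. i \<in> P \<Longrightarrow> b i = p i"
    and b_not_P: "\<And>i. i \<notin> P \<Longrightarrow> \<exists>S. finite S \<and> S \<subseteq> P \<and> preserves_psd_on I \<rho>
      (\<lambda>t. (1/2)^(i+2) * (\<Sum>k\<in>S. p k * t powr n k) + b i * t powr n i)"
  shows "preserves_psd_on I \<rho> (\<lambda>t. \<Sum>i. b i * t powr n i)"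
proof (rule preserves_psd_onI)
  fix a x
  assume a: "psd_on I a" "\<And>i j. i \<in> I \<Longrightarrow> j \<in> I \<Longrightarrow> a i j \<in> {0<..<\<rho>}"
  define q where "q i = quad_form I (\<lambda>r s. a r s powr n i) x" for i
  have q: "0 \<le> q i" for i
    unfolding q_def using preserves_psd_onD[OF powers a] by (rule psd_on_quad_form)
  have sums_q: "(\<lambda>i. c i * q i) sums quad_form I (\<lambda>r s. \<Sum>i. c i * a r s powr n i) x"
    if c: "\<And>i. \<bar>c i\<bar> \<le> p i" for c
  proof -
    have "summable (\<lambda>i. c i * t powr n i)" if "t \<in> {0<..<\<rho>}" for t
    proof (rule summable_comparison_test'[OF summable_p[OF that]])
      show "norm (c i * t powr n i) \<le> p i * t powr n i" if "i \<ge> 0" for i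
        using c[of i] by (simp add: abs_mult mult_right_mono)
    qed
    then have "(\<lambda>i. quad_form I (\<lambda>r s. c i * a r s powr n i) x)
        sums quad_form I (\<lambda>r s. \<Sum>i. c i * a r s powr n i) x"
      using a(2) by (intro quad_form_sums[OF fin, of "\<lambda>i t. c i * t powr n i"] summable_sums) auto
    then show ?thesis by (simp add: quad_form_scale q_def)
  qed
  define pos where "pos i = (if i \<in> P then p i * q i else 0)" for i
  have "summable (\<lambda>i. (if i \<in> P then p i else 0) * q i)"
    using p by (intro sums_summable[OF sums_q]) (auto simp: less_imp_le)
  then have pos: "summable pos"
    by (rule back_subst[of summable]) (auto simp: pos_def)
  have pos_nonneg: "0 \<le> pos i" for i
    using p q by (simp add: pos_def less_imp_le)
  have "(\<lambda>i. (1/2)^i) sums (2::real)" using geometric_sums[of "1/2::real"] by simp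
  then have "(\<lambda>i. pos i - (1/2)^i * (suminf pos / 4)) sums (suminf pos - 2 * (suminf pos / 4))"
    by (intro sums_diff sums_mult2 summable_sums[OF pos])
  then have lower: "(\<lambda>i. pos i - (1/2)^i * (suminf pos / 4)) sums (suminf pos / 2)" by simp
  have "pos i - (1/2)^i * (suminf pos / 4) \<le> b i * q i" for i
  proof -
    have pos_total: "0 \<le> suminf pos" using suminf_nonneg[OF pos] pos_nonneg by simp
    show ?thesis
    proof (cases "i \<in> P")
      case True
      then show ?thesis using pos_total b_P by (simp add: pos_def)
    next
      case False
      then obtain S where S: "finite S" "S \<subseteq> P" "preserves_psd_on I \<rho>
          (\<lambda>t. (1/2)^(i+2) * (\<Sum>k\<in>S. p k * t powr n k) + b i * t powr n i)"
        using b_not_P by blast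
      have "0 \<le> quad_form I
          (\<lambda>r s. (1/2)^(i+2) * (\<Sum>k\<in>S. p k * a r s powr n k) + b i * a r s powr n i) x"
        using preserves_psd_onD[OF S(3) a] by (rule psd_on_quad_form)
      also have "\<dots> = (1/2)^(i+2) * (\<Sum>k\<in>S. p k * q k) + b i * q i"
        unfolding quad_form_add quad_form_scale quad_form_sum q_def ..
      finally have "- (b i * q i) \<le> (1/2)^(i+2) * (\<Sum>k\<in>S. p k * q k)" by linarith
      also have "\<dots> = (1/2)^(i+2) * (\<Sum>k\<in>S. pos k)"
        using S(2) by (auto simp: pos_def intro!: sum.cong)
      also have "\<dots> \<le> (1/2)^(i+2) * suminf pos"
        using S(1) pos pos_nonneg by (intro mult_left_mono sum_le_suminf) auto
      finally show ?thesis using False by (simp add: pos_def)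
    qed
  qed
  then have "suminf pos / 2 \<le> quad_form I (\<lambda>r s. \<Sum>i. b i * a r s powr n i) x"
    by (rule sums_le[OF _ lower sums_q[OF b_le]])
  moreover have "0 \<le> suminf pos" using suminf_nonneg[OF pos] pos_nonneg by simp
  ultimately show "0 \<le> quad_form I (\<lambda>r s. \<Sum>i. b i * a r s powr n i) x" by linarith
qed

section \<open>Realising a sign pattern\<close>

text \<open>Positive coefficients are the weights \<open>p i\<close>; each negative coefficient is chosen so small that \<open>N\<close>
  positive terms of lower degree can absorb it.\<close>

theorem theorem5p6:
  fixes N :: nat
    and n :: "nat \<Rightarrow> real"
    and \<epsilon> :: "nat \<Rightarrow> int"
    and \<rho> :: real
  assumes "N \<ge> 2"
    and "\<And>i. n i \<in> \<nat> \<union> {real N - 2..}"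
    and "inj n"
    and "\<And>i. \<epsilon> i \<in> {-1, 0, 1}"
    and "\<And>i0. \<epsilon> i0 = -1 \<Longrightarrow>
           \<exists>S. finite S \<and> card S = N \<and> S \<subseteq> {i. \<epsilon> i = 1 \<and> n i < n i0}"
    and "0 < \<rho>"
  shows "\<exists>(c :: real \<Rightarrow> real) (f :: complex \<Rightarrow> complex).
           (\<forall>x \<in> {0<..<\<rho>}.
              (\<lambda>i. complex_of_real (c (n i) * x powr n i)) sums f (complex_of_real x)) \<and>
           entrywise_positivity_preserver f N (complex_of_real ` {0<..<\<rho>}) \<and>
           (\<forall>i. sgn (c (n i)) = real_of_int (\<epsilon> i))"
proof -
  obtain m where m: "N = Suc m" using assms(1) by (cases N) auto
  have exponent: "preserving_exponent (Suc m) (n i)" for i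
    using assms(2)[of i] by (simp add: preserving_exponent_def m)
  have n0: "0 \<le> n i" for i
    using preserving_exponent_nonneg[OF exponent] assms(1) m by simp
  have powers: "preserves_psd_on {..<N} \<rho> (\<lambda>t. t powr n i)" for i
    using exponent assms(6) m by (intro powr_preserves_psd[of _ m]) auto
  \<comment> \<open>These weights make the series converge geometrically on the whole interval.\<close>
  define p where "p i = (1/2)^i / (1 + \<rho> powr n i)" for i
  have p: "0 < p i" for i by (simp add: p_def add_pos_nonneg)
  have p_bound: "norm (p i * t powr n i) \<le> (1/2)^i" if "t \<in> {0<..<\<rho>}" for t i
  proof -
    have "t powr n i \<le> 1 + \<rho> powr n i"
      using powr_mono2[OF n0[of i], of t \<rho>] that by simp
    then have "p i * t powr n i \<le> p i * (1 + \<rho> powr n i)"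
      using p[of i] by (intro mult_left_mono) auto
    also have "\<dots> = (1/2)^i"
      using powr_ge_zero[of \<rho> "n i"] by (simp add: p_def add_nonneg_eq_0_iff)
    finally show ?thesis using p[of i] by (simp add: abs_mult)
  qed
  have summable_p: "summable (\<lambda>i. p i * t powr n i)" if "t \<in> {0<..<\<rho>}" for t
    by (rule summable_comparison_test'[of "\<lambda>i. (1/2)^i" 0])
      (use p_bound[OF that] in \<open>auto simp: summable_geometric\<close>)
  have "\<exists>\<eta> S. 0 < \<eta> \<and> \<eta> \<le> p i \<and> finite S \<and> S \<subseteq> {k. \<epsilon> k = 1} \<and>
      preserves_psd_on {..<N} \<rho>
        (\<lambda>t. (1/2)^(i+2) * (\<Sum>k\<in>S. p k * t powr n k) + - \<eta> * t powr n i)"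
    if neg: "\<epsilon> i = -1" for i
  proof -
    obtain S where S: "finite S" "card S = N" "S \<subseteq> {k. \<epsilon> k = 1 \<and> n k < n i}"
      using assms(5)[OF neg] by blast
    have "\<exists>C\<ge>0. preserves_psd_on {..<N} \<rho> (\<lambda>t. C * (\<Sum>k\<in>S. t powr n k) - t powr n i)"
      using S exponent assms(3,6) m by (intro power_domination[of _ m]) (auto intro: inj_on_subset)
    then obtain C where C: "0 \<le> C"
      "preserves_psd_on {..<N} \<rho> (\<lambda>t. C * (\<Sum>k\<in>S. t powr n k) - t powr n i)" by blast
    \<comment> \<open>At most \<open>p i\<close> for convergence; the other bounds let \<open>S\<close> pay for this term with a
      \<open>2\<^bsup>-(i+2)\<^esup>\<close> share of its weights.\<close>
    define \<eta> where "\<eta> = Min (insert (p i) ((\<lambda>k. (1/2)^(i+2) * p k / (1 + C)) ` S))"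
    have \<eta>: "0 < \<eta>" "\<eta> \<le> p i"
      unfolding \<eta>_def using S(1) C(1) p by auto
    have "\<eta> * C \<le> (1/2)^(i+2) * p k" if "k \<in> S" for k
    proof -
      have "\<eta> \<le> (1/2)^(i+2) * p k / (1 + C)"
        unfolding \<eta>_def using S(1) that by (intro Min_le) auto
      moreover have "0 < 1 + C" using C(1) by simp
      ultimately have "\<eta> * (1 + C) \<le> (1/2)^(i+2) * p k"
        by (simp only: pos_le_divide_eq)
      then show ?thesis using \<eta>(1) by (simp add: algebra_simps)
    qed
    then have "preserves_psd_on {..<N} \<rho> (\<lambda>t. (\<Sum>k\<in>S. ((1/2)^(i+2) * p k - \<eta> * C) * t powr n k)
        + \<eta> * (C * (\<Sum>k\<in>S. t powr n k) - t powr n i))"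
      using C(2) \<eta>(1) powers
      by (intro preserves_psd_on_add preserves_psd_on_sum preserves_psd_on_scale) auto
    moreover have "(\<Sum>k\<in>S. ((1/2)^(i+2) * p k - \<eta> * C) * t powr n k)
        + \<eta> * (C * (\<Sum>k\<in>S. t powr n k) - t powr n i)
        = (1/2)^(i+2) * (\<Sum>k\<in>S. p k * t powr n k) + - \<eta> * t powr n i" for t
      by (simp add: left_diff_distrib right_diff_distrib sum_subtractf sum_distrib_left mult.assoc)
    ultimately show ?thesis using S \<eta> by (intro exI[of _ \<eta>] exI[of _ S]) auto
  qed
  then have "\<forall>i. \<exists>\<eta>. \<epsilon> i = -1 \<longrightarrow> 0 < \<eta> \<and> \<eta> \<le> p i \<and>
      (\<exists>S. finite S \<and> S \<subseteq> {k. \<epsilon> k = 1} \<and> preserves_psd_on {..<N} \<rho>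
        (\<lambda>t. (1/2)^(i+2) * (\<Sum>k\<in>S. p k * t powr n k) + - \<eta> * t powr n i))"
    by blast
  from choice[OF this] obtain \<eta> where \<eta>: "\<And>i. \<epsilon> i = -1 \<Longrightarrow> 0 < \<eta> i \<and> \<eta> i \<le> p i \<and>
      (\<exists>S. finite S \<and> S \<subseteq> {k. \<epsilon> k = 1} \<and> preserves_psd_on {..<N} \<rho>
        (\<lambda>t. (1/2)^(i+2) * (\<Sum>k\<in>S. p k * t powr n k) + - \<eta> i * t powr n i))"
    by blast
  define b where "b i = (if \<epsilon> i = 1 then p i else if \<epsilon> i = -1 then - \<eta> i else 0)" for i
  have b_le: "\<bar>b i\<bar> \<le> p i" for i
    using p[of i] \<eta>[of i] by (auto simp: b_def)
  define g where "g t = (\<Sum>i. b i * t powr n i)" for t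
  have g_sums: "(\<lambda>i. b i * t powr n i) sums g t" if "t \<in> {0<..<\<rho>}" for t
    unfolding g_def
  proof (intro summable_sums summable_comparison_test'[OF summable_p[OF that]])
    show "norm (b i * t powr n i) \<le> p i * t powr n i" if "i \<ge> 0" for i
      using b_le[of i] by (simp add: abs_mult mult_right_mono)
  qed
  have "preserves_psd_on {..<N} \<rho> g"
    unfolding g_def
  proof (rule series_preserves_psd[where P = "{k. \<epsilon> k = 1}", OF _ powers _ summable_p b_le])
    fix i assume i: "i \<notin> {k. \<epsilon> k = 1}"
    show "\<exists>S. finite S \<and> S \<subseteq> {k. \<epsilon> k = 1} \<and> preserves_psd_on {..<N} \<rho>
        (\<lambda>t. (1/2)^(i+2) * (\<Sum>k\<in>S. p k * t powr n k) + b i * t powr n i)"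
    proof (cases "\<epsilon> i = -1")
      case True
      then show ?thesis using \<eta>[OF True] by (simp add: b_def)
    next
      case False
      then have "b i = 0" using i by (simp add: b_def)
      then show ?thesis
        by (intro exI[of _ "{}"]) (simp add: preserves_psd_onI quad_form_def)
    qed
  qed (use p less_imp_le in \<open>auto simp: b_def\<close>)
  then have "entrywise_positivity_preserver (\<lambda>z. complex_of_real (g (Re z))) N
      (complex_of_real ` {0<..<\<rho>})"
    by (rule entrywise_positivity_preserver_of_real)
  moreover have "(\<lambda>i. complex_of_real (b (inv_into UNIV n (n i)) * x powr n i))
      sums complex_of_real (g (Re (complex_of_real x)))" if "x \<in> {0<..<\<rho>}" for x
    using g_sums[OF that] assms(3) by (simp only: sums_of_real_iff inv_f_f Re_complex_of_real)
  moreover have "sgn (b (inv_into UNIV n (n i))) = real_of_int (\<epsilon> i)" for i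
    using assms(3) assms(4)[of i] p[of i] \<eta>[of i] by (auto simp: b_def)
  ultimately show ?thesis
    by (intro exI[of _ "\<lambda>r. b (inv_into UNIV n r)"] exI[of _ "\<lambda>z. complex_of_real (g (Re z))"]) simp
qed

end
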